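(* Let $\mathcal{H}$ be a complex Hilbert space, let $\mathcal{L}:\mathcal{D}(\mathcal{L})\rightarrow\mathcal{H}$ be a closed and densely defined linear operator on $\mathcal{H}$, and let $Q:\mathbb{C}^m\rightarrow\mathcal{H}$ be a linear map satisfying $Q^*Q=I$ whose range is an invariant subspace of $\mathcal{L}$. Let $L=Q^*\mathcal{L}Q\in\mathbb{C}^{m\times m}$. Let $\lambda$ be a simple eigenvalue of $\mathcal{L}$ with condition number $\kappa_{\mathcal{H}}(\lambda)$, and suppose that the nonzero vectors $u\in{\rm range}(Q)$ and $w\in\mathcal{D}(\mathcal{L}^* )$ satisfy $\mathcal{L}u=\lambda u$ and $\mathcal{L}^*w=\overline{\lambda}w$, where $\mathcal{L}^*$ denotes the adjoint of $\mathcal{L}$. Then: 1) $LQ^*u=\lambda Q^*u$ and $L^*Q^*w=\overline{\lambda}\,Q^*w$; 2) $(Q^*w,Q^*u)_{\mathbb{C}^m}=(w,u)_{\mathcal{H}}$; 3) $\kappa_{\mathbb{C}^m}(\lambda)\leq\kappa_{\mathcal{H}}(\lambda)$, where $\kappa_{\mathbb{C}^m}(\lambda)$ is the condition number of $\lambda$ as an eigenvalue of the matrix $L$, with right eigenvector $Q^*u$ and left eigenvector $Q^*w$.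
   Context: Inner products are conjugate-linear in the first argument and linear in the second. $\mathbb{C}^m$ carries the standard inner product. $Q^*:\mathcal{H}\to\mathbb{C}^m$ is the adjoint of $Q$; if $Q$ has columns $q_1,\dots,q_m\in\mathcal{H}$, then $(Q^*f)_i=(q_i,f)_{\mathcal{H}}$ and $L_{ij}=(q_i,\mathcal{L}q_j)_{\mathcal{H}}$. That ${\rm range}(Q)$ is an invariant subspace of $\mathcal{L}$ means ${\rm range}(Q)\subset\mathcal{D}(\mathcal{L})$ and $\mathcal{L}({\rm range}(Q))\subset{\rm range}(Q)$. A simple eigenvalue of $\mathcal{L}$ is an isolated point $\lambda$ of the spectrum of $\mathcal{L}$ whose spectral projector $\frac{1}{2\pi i}\oint(z\mathcal{I}-\mathcal{L})^{-1}dz$ (over a small circle around $\lambda$ enclosing no other point of the spectrum) has rank one. Condition number: if $A$ is a closed, densely defined operator on a Hilbert space $H$ with simple eigenvalue $\lambda$, and $u,w\in H$ are nonzero with $Au=\lambda u$ and $A^*w=\overline{\lambda}w$, the condition number of $\lambda$ is $$\kappa_H(\lambda)=\frac{\lVert u\rVert_H\lVert w\rVert_H}{|(w,u)_H|}.$$ Thus $\kappa_{\mathcal{H}}(\lambda)=\lVert u\rVert_{\mathcal{H}}\lVert w\rVert_{\mathcal{H}}/|(w,u)_{\mathcal{H}}|$ and $\kappa_{\mathbb{C}^m}(\lambda)=\lVert Q^*u\rVert_{\mathbb{C}^m}\lVert Q^*w\rVert_{\mathbb{C}^m}/|(Q^*w,Q^*u)_{\mathbb{C}^m}|$. *)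

theory Defs
  imports "HOL-Analysis.Analysis" "HOL-Complex_Analysis.Contour_Integration"
begin

section \<open>Complex Hilbert spaces\<close>

text \<open>The inner product is conjugate-linear in the first argument and linear in the second; the
  topology is the one given by the norm it induces.\<close>

class complex_inner = real_normed_vector +
  fixes scaleC :: "complex \<Rightarrow> 'a \<Rightarrow> 'a" (infixr \<open>*\<^sub>C\<close> 75)
    and cinner :: "'a \<Rightarrow> 'a \<Rightarrow> complex"
  assumes scaleC_add_right: "a *\<^sub>C (x + y) = a *\<^sub>C x + a *\<^sub>C y"
    and scaleC_add_left: "(a + b) *\<^sub>C x = a *\<^sub>C x + b *\<^sub>C x"
    and scaleC_scaleC: "a *\<^sub>C b *\<^sub>C x = (a * b) *\<^sub>C x"
    and scaleR_scaleC: "r *\<^sub>R x = complex_of_real r *\<^sub>C x"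
    and cinner_commute: "cinner x y = cnj (cinner y x)"
    and cinner_add_right: "cinner x (y + z) = cinner x y + cinner x z"
    and cinner_scaleC_right: "cinner x (a *\<^sub>C y) = a * cinner x y"
    and cinner_self: "cinner x x = complex_of_real ((norm x)\<^sup>2)"

class chilbert_space = complex_inner + banach

global_interpretation complex_vector:
  vector_space "scaleC :: complex \<Rightarrow> 'a \<Rightarrow> 'a::complex_inner"
proof
  fix x :: 'a
  show "1 *\<^sub>C x = x"
    using scaleR_scaleC[of 1 x] by simp
qed (simp_all add: scaleC_add_right scaleC_add_left scaleC_scaleC)

instantiation complex :: chilbert_space
begin

definition scaleC_complex :: "complex \<Rightarrow> complex \<Rightarrow> complex"
  where "scaleC_complex a x = a * x"

definition cinner_complex :: "complex \<Rightarrow> complex \<Rightarrow> complex"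
  where "cinner_complex x y = cnj x * y"

instance
proof
  fix x :: complex
  show "cinner x x = complex_of_real ((norm x)\<^sup>2)"
    by (simp add: cinner_complex_def complex_norm_square mult.commute del: of_real_power)
qed (simp_all add: scaleC_complex_def cinner_complex_def algebra_simps scaleR_conv_of_real)

end

instantiation vec :: (chilbert_space, finite) chilbert_space
begin

definition scaleC_vec :: "complex \<Rightarrow> 'a ^ 'b \<Rightarrow> 'a ^ 'b"
  where "scaleC_vec a x = (\<chi> i. a *\<^sub>C x $ i)"

definition cinner_vec :: "'a ^ 'b \<Rightarrow> 'a ^ 'b \<Rightarrow> complex"
  where "cinner_vec x y = (\<Sum>i\<in>UNIV. cinner (x $ i) (y $ i))"

instance
proof
  fix x y :: "'a ^ 'b"
  show "cinner x y = cnj (cinner y x)"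
    using cinner_commute by (auto simp: cinner_vec_def intro!: sum.cong)
  show "cinner x x = complex_of_real ((norm x)\<^sup>2)"
    by (simp add: cinner_vec_def norm_vec_def L2_set_def sum_nonneg cinner_self)
qed (simp_all add: scaleC_vec_def cinner_vec_def vec_eq_iff scaleC_add_right scaleC_add_left
      scaleC_scaleC scaleR_scaleC cinner_add_right cinner_scaleC_right sum.distrib sum_distrib_left)

end

lemma scaleC_vec_eq: "a *\<^sub>C x = a *s x" for x :: "complex ^ 'n"
  by (simp add: scaleC_vec_def scaleC_complex_def vec_eq_iff)


section \<open>Unbounded operators\<close>

text \<open>An operator is given by its domain \<open>D\<close> and a total function \<open>A\<close> whose values outside \<open>D\<close> are
  irrelevant.\<close>

definition linear_operator ::
    "'a::complex_inner set \<Rightarrow> ('a \<Rightarrow> 'b::complex_inner) \<Rightarrow> bool" where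
  "linear_operator D A \<longleftrightarrow> complex_vector.subspace D \<and>
     (\<forall>x\<in>D. \<forall>y\<in>D. A (x + y) = A x + A y) \<and> (\<forall>c. \<forall>x\<in>D. A (c *\<^sub>C x) = c *\<^sub>C A x)"

definition closed_operator ::
    "'a::complex_inner set \<Rightarrow> ('a \<Rightarrow> 'b::complex_inner) \<Rightarrow> bool" where
  "closed_operator D A \<longleftrightarrow> linear_operator D A \<and> closed ((\<lambda>x. (x, A x)) ` D)"

definition densely_defined :: "'a::complex_inner set \<Rightarrow> bool" where
  "densely_defined D \<longleftrightarrow> closure D = UNIV"

definition adjoint_domain ::
    "'a::complex_inner set \<Rightarrow> ('a \<Rightarrow> 'b::complex_inner) \<Rightarrow> 'b set" where
  "adjoint_domain D A = {w. \<exists>v. \<forall>f\<in>D. cinner w (A f) = cinner v f}"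

text \<open>For dense \<open>D\<close> the vector \<open>v\<close> below is unique. The adjoint of an everywhere defined
  operator \<open>A\<close> is \<open>op_adjoint UNIV A\<close>.\<close>

definition op_adjoint ::
    "'a::complex_inner set \<Rightarrow> ('a \<Rightarrow> 'b::complex_inner) \<Rightarrow> 'b \<Rightarrow> 'a" where
  "op_adjoint D A w = (THE v. \<forall>f\<in>D. cinner w (A f) = cinner v f)"

definition conjugate_transpose :: "complex ^ 'n ^ 'm \<Rightarrow> complex ^ 'm ^ 'n" where
  "conjugate_transpose M = (\<chi> i j. cnj (M $ j $ i))"


section \<open>Simple eigenvalues and condition numbers\<close>

definition resolvent :: "'a::complex_inner set \<Rightarrow> ('a \<Rightarrow> 'a) \<Rightarrow> complex \<Rightarrow> 'a \<Rightarrow> 'a" where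
  "resolvent D A z = the_inv_into D (\<lambda>x. z *\<^sub>C x - A x)"

definition resolvent_set :: "'a::complex_inner set \<Rightarrow> ('a \<Rightarrow> 'a) \<Rightarrow> complex set" where
  "resolvent_set D A =
     {z. bij_betw (\<lambda>x. z *\<^sub>C x - A x) D UNIV \<and> bounded_linear (resolvent D A z)}"

definition spectrum :: "'a::complex_inner set \<Rightarrow> ('a \<Rightarrow> 'a) \<Rightarrow> complex set" where
  "spectrum D A = - resolvent_set D A"

text \<open>The Hilbert-space-valued analogue of \<^const>\<open>contour_integral\<close>.\<close>

definition vec_contour_integral :: "(real \<Rightarrow> complex) \<Rightarrow> (complex \<Rightarrow> 'a) \<Rightarrow> 'a::complex_inner" where
  "vec_contour_integral g F =
     integral {0..1} (\<lambda>t. vector_derivative g (at t within {0..1}) *\<^sub>C F (g t))"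

text \<open>The operator-valued integral is taken pointwise; on a circle inside the resolvent set the
  integrand is norm continuous, so this agrees with the integral in operator norm.\<close>

definition spectral_projector ::
    "'a::complex_inner set \<Rightarrow> ('a \<Rightarrow> 'a) \<Rightarrow> complex \<Rightarrow> real \<Rightarrow> 'a \<Rightarrow> 'a" where
  "spectral_projector D A lam r f =
     (1 / (2 * of_real pi * \<i>)) *\<^sub>C
       vec_contour_integral (circlepath lam r) (\<lambda>z. resolvent D A z f)"

definition simple_eigenvalue ::
    "'a::complex_inner set \<Rightarrow> ('a \<Rightarrow> 'a) \<Rightarrow> complex \<Rightarrow> bool" where
  "simple_eigenvalue D A lam \<longleftrightarrow> lam isolated_in spectrum D A \<and>
     (\<exists>r>0. cball lam r \<inter> spectrum D A = {lam} \<and>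
        complex_vector.dim (range (spectral_projector D A lam r)) = 1)"

text \<open>The condition number is defined only for a simple eigenvalue of a closed, densely defined
  operator, with nonzero right and left eigenvectors \<open>u\<close> and \<open>w\<close>. In that case
  \<open>cinner w u\<close> is nonzero, because the spectral projector has rank one; otherwise the value is
  unspecified, so nothing can be asserted about it.\<close>

definition condition_number ::
    "'a::complex_inner set \<Rightarrow> ('a \<Rightarrow> 'a) \<Rightarrow> complex \<Rightarrow> 'a \<Rightarrow> 'a \<Rightarrow> real" where
  "condition_number D A lam u w =
     (if closed_operator D A \<and> densely_defined D \<and> simple_eigenvalue D A lam \<and>
         u \<in> D \<and> u \<noteq> 0 \<and> A u = lam *\<^sub>C u \<and>
         w \<in> adjoint_domain D A \<and> w \<noteq> 0 \<and> op_adjoint D A w = cnj lam *\<^sub>C w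
      then norm u * norm w / cmod (cinner w u)
      else undefined)"

end

theory Submission
  imports Defs
begin

text \<open>On the invariant subspace the resolvents are intertwined by \<open>Q\<close>, so the spectrum of the matrix
  \<open>L\<close> lies in that of \<open>\<L>\<close> and \<open>Q\<close> maps the range of its spectral projector \<open>P\<^sub>L\<close> into the range of
  the spectral projector \<open>P\<close> of \<open>\<L>\<close>. The latter is spanned by \<open>u\<close>, so \<open>\<lambda>\<close> is a simple eigenvalue of
  \<open>L\<close>. Moreover \<open>(w, P f) = (w, f)\<close> for all \<open>f\<close>; taking \<open>f = w\<close> and using that \<open>P w\<close> is a multiple of
  \<open>u\<close> gives \<open>(w, u) \<noteq> 0\<close>, hence \<open>Q\<^sup>*w \<noteq> 0\<close>. The inequality then holds because \<open>Q\<close> is isometric and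
  \<open>Q\<^sup>*\<close> is a contraction.\<close>

section \<open>Complex inner products\<close>

lemma cinner_scaleC_left: "cinner (a *\<^sub>C x) y = cnj a * cinner x y"
  by (metis cinner_commute cinner_scaleC_right complex_cnj_mult)

lemma cinner_add_left: "cinner (x + y) z = cinner x z + cinner y z"
  by (metis cinner_commute cinner_add_right complex_cnj_add)

lemma cinner_minus_right: "cinner x (- y) = - cinner x y"
  using cinner_scaleC_right[of x "-1" y] by simp

lemma cinner_diff_right: "cinner x (y - z) = cinner x y - cinner x z"
  using cinner_add_right[of x y "- z"] by (simp add: cinner_minus_right)

lemma cinner_diff_left: "cinner (x - y) z = cinner x z - cinner y z"
  by (metis cinner_commute cinner_diff_right complex_cnj_diff)

lemma cinner_zero_right [simp]: "cinner x 0 = 0"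
  using cinner_diff_right[of x 0 0] by simp

lemma cinner_zero_left [simp]: "cinner 0 x = 0"
  using cinner_diff_left[of 0 0 x] by simp

lemma cinner_eq_zero_iff [simp]: "cinner x x = 0 \<longleftrightarrow> x = 0"
  by (simp add: cinner_self)

lemma norm_scaleC: "norm (a *\<^sub>C x) = cmod a * norm x"
proof -
  have "complex_of_real ((norm (a *\<^sub>C x))\<^sup>2) = cinner (a *\<^sub>C x) (a *\<^sub>C x)"
    by (rule cinner_self[symmetric])
  also have "\<dots> = cnj a * (a * complex_of_real ((norm x)\<^sup>2))"
    by (simp only: cinner_scaleC_left cinner_scaleC_right) (simp only: cinner_self mult.left_commute)
  also have "\<dots> = complex_of_real ((cmod a * norm x)\<^sup>2)"
    by (simp add: power_mult_distrib complex_norm_square mult_ac del: of_real_power)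
  finally have "complex_of_real ((norm (a *\<^sub>C x))\<^sup>2) = complex_of_real ((cmod a * norm x)\<^sup>2)" .
  then show ?thesis
    by (simp only: of_real_eq_iff power2_eq_iff_nonneg norm_ge_zero mult_nonneg_nonneg)
qed

text \<open>Cauchy-Schwarz: the component \<open>z\<close> of \<open>y\<close> orthogonal to
  \<open>x\<close> has nonnegative squared norm.\<close>

lemma norm_cinner_le: "cmod (cinner x y) \<le> norm x * norm y"
proof (cases "x = 0")
  case False
  define a where "a = cinner x y / complex_of_real ((norm x)\<^sup>2)"
  define z where "z = y - a *\<^sub>C x"
  have xz: "cinner x z = 0"
    using False by (simp add: z_def a_def cinner_diff_right cinner_scaleC_right cinner_self)
  have "complex_of_real ((norm z)\<^sup>2) = cinner y z"
    using xz cinner_self[of z] by (simp add: z_def cinner_diff_left cinner_scaleC_left)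
  also have "\<dots> = complex_of_real ((norm y)\<^sup>2) - a * cnj (cinner x y)"
    by (simp add: z_def cinner_diff_right cinner_scaleC_right cinner_self cinner_commute[of y x])
  also have "a * cnj (cinner x y) = complex_of_real ((cmod (cinner x y))\<^sup>2 / (norm x)\<^sup>2)"
    by (simp add: a_def complex_norm_square del: of_real_power)
  finally have "complex_of_real ((norm z)\<^sup>2)
      = complex_of_real ((norm y)\<^sup>2 - (cmod (cinner x y))\<^sup>2 / (norm x)\<^sup>2)"
    by simp
  then have "(norm z)\<^sup>2 = (norm y)\<^sup>2 - (cmod (cinner x y))\<^sup>2 / (norm x)\<^sup>2"
    by (simp only: of_real_eq_iff)
  then have "(cmod (cinner x y))\<^sup>2 / (norm x)\<^sup>2 \<le> (norm y)\<^sup>2"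
    by (smt (verit) zero_le_power2)
  then have "(cmod (cinner x y))\<^sup>2 \<le> (norm x * norm y)\<^sup>2"
    using False by (simp add: field_simps power_mult_distrib)
  then show ?thesis
    by (rule power2_le_imp_le) simp
qed simp

lemma bounded_bilinear_scaleC: "bounded_bilinear ((*\<^sub>C) :: complex \<Rightarrow> 'a \<Rightarrow> 'a::complex_inner)"
proof
  show "\<exists>K. \<forall>a (x::'a). norm (a *\<^sub>C x) \<le> norm a * norm x * K"
    by (rule exI[of _ 1]) (simp add: norm_scaleC)
qed (simp_all add: scaleC_add_left scaleC_add_right scaleR_scaleC[where 'a = 'a] scaleC_scaleC
      scaleR_conv_of_real mult.commute)

lemma bounded_linear_cinner_right: "bounded_linear (cinner w)"
proof (rule bounded_linear_intro[where K = "norm w"])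
  show "norm (cinner w x) \<le> norm x * norm w" for x
    by (metis norm_cinner_le mult.commute)
qed (simp_all add: cinner_add_right scaleR_scaleC cinner_scaleC_right scaleC_complex_def)

lemma cinner_eqI:
  assumes "\<And>x. cinner v x = cinner v' x"
  shows "v = v'"
proof -
  have "cinner (v - v') (v - v') = 0"
    using assms by (simp add: cinner_diff_left)
  then show ?thesis
    by simp
qed

text \<open>Two continuous functionals that agree on a dense set agree everywhere. This is the
  uniqueness that gives meaning to the \<open>THE\<close> in \<open>op_adjoint\<close>.\<close>

lemma cinner_eqI_dense:
  assumes "densely_defined D" and "\<And>x. x \<in> D \<Longrightarrow> cinner v x = cinner v' x"
  shows "v = v'"
proof (rule cinner_eqI)
  fix x
  have "x \<in> closure D"
    using assms(1) by (simp add: densely_defined_def)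
  moreover have "continuous_on (closure D) (\<lambda>x. cinner v x - cinner v' x)"
    by (intro continuous_intros bounded_linear.continuous_on[OF bounded_linear_cinner_right])
  ultimately have "cinner v x - cinner v' x = 0"
    by (rule continuous_constant_on_closure[rotated 2]) (simp_all add: assms(2))
  then show "cinner v x = cinner v' x"
    by simp
qed

section \<open>Adjoints of operators, of matrices and of linear maps out of \<complex>^m\<close>

lemma cinner_op_adjoint:
  assumes "densely_defined D" and "w \<in> adjoint_domain D A" and "f \<in> D"
  shows "cinner w (A f) = cinner (op_adjoint D A w) f"
proof -
  obtain v where v: "\<forall>f\<in>D. cinner w (A f) = cinner v f"
    using assms(2) by (auto simp: adjoint_domain_def)
  have "\<forall>f\<in>D. cinner w (A f) = cinner (op_adjoint D A w) f"
    unfolding op_adjoint_def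
    by (rule theI[of _ v]) (use v in \<open>auto intro: cinner_eqI_dense[OF assms(1)]\<close>)
  then show ?thesis
    using assms(3) by blast
qed

lemma op_adjoint_eqI:
  assumes "densely_defined D" and "\<And>f. f \<in> D \<Longrightarrow> cinner w (A f) = cinner v f"
  shows "op_adjoint D A w = v"
  unfolding op_adjoint_def
  by (rule the_equality) (use assms in \<open>auto intro: cinner_eqI_dense[OF assms(1)]\<close>)

lemma densely_defined_UNIV [simp]: "densely_defined UNIV"
  by (simp add: densely_defined_def)

lemma cinner_conjugate_transpose: "cinner (conjugate_transpose M *v y) x = cinner y (M *v x)"
proof -
  have "cinner (conjugate_transpose M *v y) x
      = (\<Sum>i\<in>UNIV. \<Sum>j\<in>UNIV. cnj (y $ j) * (M $ j $ i * x $ i))"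
    by (simp add: cinner_vec_def cinner_complex_def conjugate_transpose_def
        matrix_vector_mult_def sum_distrib_left mult_ac)
  also have "\<dots> = (\<Sum>j\<in>UNIV. \<Sum>i\<in>UNIV. cnj (y $ j) * (M $ j $ i * x $ i))"
    by (rule sum.swap)
  also have "\<dots> = cinner y (M *v x)"
    by (simp add: cinner_vec_def cinner_complex_def matrix_vector_mult_def sum_distrib_left)
  finally show ?thesis .
qed

text \<open>Expanding \<open>x\<close> in the standard basis represents the functional
  \<open>cinner w (Q x)\<close> by a vector whose entries are the inner products of the columns of
  \<open>Q\<close> with \<open>w\<close>. Hence \<open>op_adjoint UNIV Q\<close> satisfies the
  adjoint identity at every vector.\<close>

lemma adjoint_domain_linear_vec:
  fixes Q :: "complex ^ 'm \<Rightarrow> 'h::complex_inner"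
  assumes "Vector_Spaces.linear scaleC scaleC Q"
  shows "adjoint_domain UNIV Q = UNIV"
proof -
  interpret Q: Vector_Spaces.linear scaleC scaleC Q
    by (fact assms)
  have "cinner w (Q x) = cinner (\<chi> i. cnj (cinner w (Q (axis i 1)))) x" for w x
  proof -
    have "Q x = Q (\<Sum>i\<in>UNIV. x $ i *\<^sub>C axis i 1)"
      by (simp add: scaleC_vec_eq basis_expansion)
    also have "\<dots> = (\<Sum>i\<in>UNIV. x $ i *\<^sub>C Q (axis i 1))"
      by (simp add: Q.sum Q.scale)
    finally have "cinner w (Q x) = (\<Sum>i\<in>UNIV. x $ i * cinner w (Q (axis i 1)))"
      by (simp add: linear_sum[OF bounded_linear.linear[OF bounded_linear_cinner_right]]
          cinner_scaleC_right)
    then show ?thesis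
      by (simp add: cinner_vec_def cinner_complex_def mult.commute)
  qed
  then have "\<exists>v. \<forall>x. cinner w (Q x) = cinner v x" for w
    by blast
  then show ?thesis
    by (simp add: adjoint_domain_def)
qed

text \<open>The form in which rank one is both used and verified: one nonzero member of
  \<open>V\<close> is known, namely an eigenvector.\<close>

lemma dim_eq_1_iff:
  fixes u :: "'a::complex_inner"
  assumes "u \<in> V" and "u \<noteq> 0"
  shows "complex_vector.dim V = 1 \<longleftrightarrow> (\<forall>v\<in>V. \<exists>c. v = c *\<^sub>C u)"
proof
  assume "complex_vector.dim V = 1"
  then obtain b where "V \<subseteq> complex_vector.span {b}"
    using complex_vector.basis_exists[of V] by (metis card_1_singletonE)
  then have b: "\<exists>c. v = c *\<^sub>C b" if "v \<in> V" for v
    using that by (auto simp: complex_vector.span_singleton)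
  obtain a where a: "u = a *\<^sub>C b"
    using b assms(1) by blast
  show "\<forall>v\<in>V. \<exists>c. v = c *\<^sub>C u"
  proof
    fix v assume "v \<in> V"
    then obtain c where "v = c *\<^sub>C b"
      using b by blast
    then have "v = (c / a) *\<^sub>C u"
      using a assms(2) by auto
    then show "\<exists>c. v = c *\<^sub>C u" ..
  qed
next
  assume "\<forall>v\<in>V. \<exists>c. v = c *\<^sub>C u"
  then show "complex_vector.dim V = 1"
    by (intro complex_vector.dim_unique[of "{u}"])
      (use assms in \<open>auto simp: complex_vector.span_singleton\<close>)
qed

section \<open>Resolvents and spectral projectors\<close>

context
  fixes D :: "'a::complex_inner set" and A z
  assumes z: "z \<in> resolvent_set D A"
begin

lemma resolvent_in_domain: "resolvent D A z f \<in> D"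
  using z the_inv_into_into[of "\<lambda>x. z *\<^sub>C x - A x" D f D]
  by (auto simp: resolvent_set_def resolvent_def bij_betw_def)

lemma resolvent_right_inverse: "z *\<^sub>C resolvent D A z f - A (resolvent D A z f) = f"
  using z f_the_inv_into_f_bij_betw[of "\<lambda>x. z *\<^sub>C x - A x" D UNIV f]
  by (auto simp: resolvent_set_def resolvent_def)

lemma resolvent_left_inverse: "x \<in> D \<Longrightarrow> resolvent D A z (z *\<^sub>C x - A x) = x"
  using z the_inv_into_f_f[of "\<lambda>x. z *\<^sub>C x - A x" D x]
  by (auto simp: resolvent_set_def resolvent_def bij_betw_def)

lemma resolvent_eqI: "x \<in> D \<Longrightarrow> z *\<^sub>C x - A x = f \<Longrightarrow> resolvent D A z f = x"
  using resolvent_left_inverse by blast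

lemma bounded_linear_resolvent: "bounded_linear (resolvent D A z)"
  using z by (simp add: resolvent_set_def)

end

text \<open>On \<open>u\<close> the operator \<open>z - A\<close> is multiplication by
  \<open>z - lam\<close>, so its inverse divides by that number.\<close>

lemma resolvent_eigenvector:
  assumes "linear_operator D A" and "z \<in> resolvent_set D A" and "z \<noteq> lam"
    and "u \<in> D" and "A u = lam *\<^sub>C u"
  shows "resolvent D A z u = (1 / (z - lam)) *\<^sub>C u"
proof (rule resolvent_eqI[OF assms(2)])
  show "(1 / (z - lam)) *\<^sub>C u \<in> D"
    using assms by (simp add: linear_operator_def complex_vector.subspace_scale)
  have "z *\<^sub>C (1 / (z - lam)) *\<^sub>C u - A ((1 / (z - lam)) *\<^sub>C u)
      = (z / (z - lam) - lam / (z - lam)) *\<^sub>C u"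
    using assms by (simp add: linear_operator_def complex_vector.scale_left_diff_distrib)
  also have "z / (z - lam) - lam / (z - lam) = 1"
    using assms(3) by (simp flip: diff_divide_distrib)
  finally show "z *\<^sub>C (1 / (z - lam)) *\<^sub>C u - A ((1 / (z - lam)) *\<^sub>C u) = u"
    by simp
qed

text \<open>The dual statement, from pairing \<open>w\<close> with \<open>(z - A) g = f\<close>. The
  eigenvector equation for the adjoint enters in weak form, where conjugate-linearity in the first
  argument turns \<open>cnj lam\<close> into \<open>lam\<close>.\<close>

lemma cinner_resolvent_left_eigenvector:
  assumes "z \<in> resolvent_set D A" and "z \<noteq> lam"
    and "\<And>f. f \<in> D \<Longrightarrow> cinner w (A f) = lam * cinner w f"
  shows "cinner w (resolvent D A z f) = cinner w f / (z - lam)"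
proof -
  let ?g = "resolvent D A z f"
  have "cinner w f = cinner w (z *\<^sub>C ?g - A ?g)"
    by (simp add: resolvent_right_inverse[OF assms(1)])
  also have "\<dots> = (z - lam) * cinner w ?g"
    using assms(3)[OF resolvent_in_domain[OF assms(1)]]
    by (simp add: cinner_diff_right cinner_scaleC_right algebra_simps)
  finally show ?thesis
    using assms(2) by simp
qed

text \<open>Strong continuity matches the pointwise contour integral. It follows from the resolvent
  identity and a bound on the resolvents that is uniform near \<open>z0\<close>.\<close>

lemma continuous_on_resolvent: "continuous_on (resolvent_set D A) (\<lambda>z. resolvent D A z f)"
  unfolding continuous_on_def
proof
  fix z0
  assume z0: "z0 \<in> resolvent_set D A"
  interpret R: bounded_linear "resolvent D A z0"
    using z0 by (rule bounded_linear_resolvent)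
  obtain C where C: "C > 0" "\<And>x. norm (resolvent D A z0 x) \<le> norm x * C"
    using R.pos_bounded by blast
  have bound: "norm (resolvent D A z f - resolvent D A z0 f) \<le> cmod (z - z0) * (2 * C * C * norm f)"
    if z: "z \<in> resolvent_set D A" and near: "cmod (z - z0) < 1 / (2 * C)" for z
  proof -
    define g where "g = resolvent D A z f"
    \<comment> \<open>Rewriting \<open>(z - A) g = f\<close> around \<open>z0\<close> and applying
      the resolvent there yields the resolvent identity.\<close>
    have "z0 *\<^sub>C g - A g = f + (z0 - z) *\<^sub>C g"
      using resolvent_right_inverse[OF z, of f]
      by (simp add: g_def complex_vector.scale_left_diff_distrib algebra_simps)
    then have g: "g = resolvent D A z0 f + resolvent D A z0 ((z0 - z) *\<^sub>C g)"
      using resolvent_left_inverse[OF z0, of g] resolvent_in_domain[OF z, of f]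
      by (simp add: g_def R.add)
    have diff: "norm (resolvent D A z0 ((z0 - z) *\<^sub>C g)) \<le> cmod (z - z0) * C * norm g"
      using C(2)[of "(z0 - z) *\<^sub>C g"] by (simp add: norm_scaleC norm_minus_commute mult_ac)
    \<comment> \<open>Within distance \<open>1 / (2 * C)\<close> the perturbation is at most half of
      \<open>norm g\<close> and can be absorbed on the left.\<close>
    have "cmod (z - z0) * C \<le> 1 / 2"
      using near C(1) by (simp add: field_simps)
    then have "cmod (z - z0) * C * norm g \<le> 1 / 2 * norm g"
      by (intro mult_right_mono) simp_all
    moreover have "norm g \<le> norm f * C + norm (resolvent D A z0 ((z0 - z) *\<^sub>C g))"
      by (subst g) (use C(2)[of f] norm_triangle_mono in blast)
    ultimately have "norm g \<le> 2 * C * norm f"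
      using diff by (simp add: mult_ac)
    then have "cmod (z - z0) * C * norm g \<le> cmod (z - z0) * C * (2 * C * norm f)"
      using C(1) by (intro mult_left_mono) simp_all
    moreover have "g - resolvent D A z0 f = resolvent D A z0 ((z0 - z) *\<^sub>C g)"
      using g by (metis add_diff_cancel_left')
    ultimately show ?thesis
      using diff unfolding g_def[symmetric] by (simp add: mult_ac)
  qed
  have "((\<lambda>z. resolvent D A z f - resolvent D A z0 f) \<longlongrightarrow> 0) (at z0 within resolvent_set D A)"
  proof (rule Lim_null_comparison)
    show "\<forall>\<^sub>F z in at z0 within resolvent_set D A.
        norm (resolvent D A z f - resolvent D A z0 f) \<le> cmod (z - z0) * (2 * C * C * norm f)"
      unfolding eventually_at using C(1) bound
      by (intro exI[of _ "1 / (2 * C)"]) (auto simp: dist_norm)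
    show "((\<lambda>z. cmod (z - z0) * (2 * C * C * norm f)) \<longlongrightarrow> 0) (at z0 within resolvent_set D A)"
      by (rule tendsto_eq_intros refl)+ simp
  qed
  then show "((\<lambda>z. resolvent D A z f) \<longlongrightarrow> resolvent D A z0 f) (at z0 within resolvent_set D A)"
    by (rule LIM_zero_cancel)
qed

section \<open>Contour integrals of vector-valued functions\<close>

lemma vec_contour_integral_cong:
  assumes "\<And>z. z \<in> path_image g \<Longrightarrow> F z = G z"
  shows "vec_contour_integral g F = vec_contour_integral g G"
  unfolding vec_contour_integral_def
  by (rule integral_cong) (simp add: assms path_image_def)

text \<open>\<open>bounded_linear\<close> expresses real linearity; the second assumption moves
  \<open>T\<close> past the complex factor given by the derivative of the path. Instances are
  \<open>cinner w\<close> and \<open>Q\<close>.\<close>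

lemma vec_contour_integral_linear:
  assumes "bounded_linear T" and "\<And>c x. T (c *\<^sub>C x) = c *\<^sub>C T x"
    and "(\<lambda>t. vector_derivative g (at t within {0..1}) *\<^sub>C F (g t)) integrable_on {0..1}"
  shows "vec_contour_integral g (\<lambda>z. T (F z)) = T (vec_contour_integral g F)"
  using integral_linear[OF assms(3,1)] by (simp add: vec_contour_integral_def o_def assms(2))

text \<open>The derivative of the circle path is \<open>2 * pi * \<i>\<close> times
  \<open>z - lam\<close>, so the integrand is constant.\<close>

lemma vec_contour_integral_circlepath_inverse:
  assumes "r > 0"
  shows "vec_contour_integral (circlepath lam r) (\<lambda>z. (1 / (z - lam)) *\<^sub>C v)
    = (2 * of_real pi * \<i>) *\<^sub>C v"
proof -
  have "vector_derivative (circlepath lam r) (at t within {0..1})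
      *\<^sub>C (1 / (circlepath lam r t - lam)) *\<^sub>C v = (2 * of_real pi * \<i>) *\<^sub>C v"
    if "t \<in> {0..1}" for t
    using that assms by (simp add: vector_derivative_circlepath01) (simp add: circlepath)
  then have "vec_contour_integral (circlepath lam r) (\<lambda>z. (1 / (z - lam)) *\<^sub>C v)
      = integral {0..1} (\<lambda>t::real. (2 * of_real pi * \<i>) *\<^sub>C v)"
    unfolding vec_contour_integral_def by (rule integral_cong)
  then show ?thesis
    by simp
qed

section \<open>Spectral projectors and eigenvectors\<close>

lemma sphere_subset_resolvent_set:
  assumes "cball lam r \<inter> spectrum D A \<subseteq> {lam}" and "r > 0"
  shows "sphere lam r \<subseteq> resolvent_set D A"
proof
  fix z
  assume "z \<in> sphere lam r"
  then have "z \<in> cball lam r" "z \<noteq> lam"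
    using assms(2) by auto
  then show "z \<in> resolvent_set D A"
    using assms(1) by (auto simp: spectrum_def)
qed

lemma spectral_projector_eigenvector:
  assumes "linear_operator D A" and "r > 0" and "sphere lam r \<subseteq> resolvent_set D A"
    and "u \<in> D" and "A u = lam *\<^sub>C u"
  shows "spectral_projector D A lam r u = u"
proof -
  have "vec_contour_integral (circlepath lam r) (\<lambda>z. resolvent D A z u)
      = vec_contour_integral (circlepath lam r) (\<lambda>z. (1 / (z - lam)) *\<^sub>C u)"
    using assms by (intro vec_contour_integral_cong resolvent_eigenvector) auto
  then show ?thesis
    using assms(2) by (simp add: spectral_projector_def vec_contour_integral_circlepath_inverse)
qed

lemma integrable_resolvent_circlepath:
  fixes D :: "'a::chilbert_space set"
  assumes "r > 0" and "sphere lam r \<subseteq> resolvent_set D A"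
  shows "(\<lambda>t. vector_derivative (circlepath lam r) (at t within {0..1})
      *\<^sub>C resolvent D A (circlepath lam r t) f) integrable_on {0..1}"
proof (rule integrable_continuous_real,
    rule bounded_bilinear.continuous_on[OF bounded_bilinear_scaleC])
  \<comment> \<open>Continuity is proved for the explicit derivative of the circle path and then
    transferred to \<open>vector_derivative\<close>.\<close>
  have "continuous_on {0..1} (\<lambda>t::real. 2 * pi * \<i> * r * exp (2 * of_real pi * \<i> * t))"
    by (intro continuous_intros)
  then show "continuous_on {0..1} (\<lambda>t. vector_derivative (circlepath lam r) (at t within {0..1}))"
    by (rule continuous_on_eq) (simp add: vector_derivative_circlepath01)
  show "continuous_on {0..1} (\<lambda>t. resolvent D A (circlepath lam r t) f)"
    using assms(1,2) path_circlepath[of lam r] path_image_circlepath_nonneg[of r lam]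
    by (intro continuous_on_compose2[OF continuous_on_resolvent[of D A f]])
      (auto simp: path_def path_image_def)
qed

text \<open>The weak form of the statement that the adjoint of the projector fixes \<open>w\<close>:
  pairing with \<open>w\<close> passes under the integral and leaves the integral of
  \<open>1 / (z - lam)\<close>.\<close>

lemma cinner_spectral_projector_left_eigenvector:
  fixes D :: "'a::chilbert_space set"
  assumes "r > 0" and "sphere lam r \<subseteq> resolvent_set D A"
    and "\<And>f. f \<in> D \<Longrightarrow> cinner w (A f) = lam * cinner w f"
  shows "cinner w (spectral_projector D A lam r f) = cinner w f"
proof -
  have "cinner w (vec_contour_integral (circlepath lam r) (\<lambda>z. resolvent D A z f))
      = vec_contour_integral (circlepath lam r) (\<lambda>z. cinner w (resolvent D A z f))"
    by (intro vec_contour_integral_linear[symmetric] bounded_linear_cinner_right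
        integrable_resolvent_circlepath assms)
      (simp_all add: cinner_scaleC_right scaleC_complex_def)
  also have "\<dots> = vec_contour_integral (circlepath lam r) (\<lambda>z. (1 / (z - lam)) *\<^sub>C cinner w f)"
  proof (rule vec_contour_integral_cong)
    fix z
    assume "z \<in> path_image (circlepath lam r)"
    then have "z \<in> resolvent_set D A" "z \<noteq> lam"
      using assms(1,2) by auto
    then show "cinner w (resolvent D A z f) = (1 / (z - lam)) *\<^sub>C cinner w f"
      using cinner_resolvent_left_eigenvector[OF _ _ assms(3)] by (simp add: scaleC_complex_def)
  qed
  also have "\<dots> = (2 * of_real pi * \<i>) *\<^sub>C cinner w f"
    by (rule vec_contour_integral_circlepath_inverse[OF assms(1)])
  finally show ?thesis
    by (simp add: spectral_projector_def cinner_scaleC_right scaleC_complex_def)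
qed

lemma spectral_projector_rank_one:
  assumes "linear_operator D A" and "r > 0" and "sphere lam r \<subseteq> resolvent_set D A"
    and "u \<in> D" and "u \<noteq> 0" and "A u = lam *\<^sub>C u"
    and "complex_vector.dim (range (spectral_projector D A lam r)) = 1"
  shows "\<exists>c. spectral_projector D A lam r f = c *\<^sub>C u"
  using assms dim_eq_1_iff[of u "range (spectral_projector D A lam r)"]
    spectral_projector_eigenvector[OF assms(1-4,6)]
  by (metis rangeI)

text \<open>The denominator of the condition number does not vanish. This will also show that
  \<open>Qstar w\<close> is nonzero.\<close>

lemma simple_eigenvalue_cinner_nonzero:
  fixes D :: "'a::chilbert_space set"
  assumes "linear_operator D A" and "simple_eigenvalue D A lam"
    and "u \<in> D" and "u \<noteq> 0" and "A u = lam *\<^sub>C u"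
    and "w \<noteq> 0" and "\<And>f. f \<in> D \<Longrightarrow> cinner w (A f) = lam * cinner w f"
  shows "cinner w u \<noteq> 0"
proof
  assume orth: "cinner w u = 0"
  obtain r where r: "r > 0" "cball lam r \<inter> spectrum D A = {lam}"
    and dim: "complex_vector.dim (range (spectral_projector D A lam r)) = 1"
    using assms(2) by (auto simp: simple_eigenvalue_def)
  have sph: "sphere lam r \<subseteq> resolvent_set D A"
    using r by (intro sphere_subset_resolvent_set) auto
  obtain c where "spectral_projector D A lam r w = c *\<^sub>C u"
    using spectral_projector_rank_one[OF assms(1) r(1) sph assms(3-5) dim] by blast
  then have "cinner w w = 0"
    using cinner_spectral_projector_left_eigenvector[OF r(1) sph assms(7), of w] orth
    by (simp add: cinner_scaleC_right)
  then show False
    using assms(6) by simp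
qed

section \<open>Compression to an invariant subspace\<close>

text \<open>\<open>M\<close> represents the restriction of \<open>A\<close> to
  \<open>range Q\<close> in the orthonormal basis formed by the columns of \<open>Q\<close>.\<close>

locale invariant_subspace =
  fixes D :: "'h::chilbert_space set"
    and A :: "'h \<Rightarrow> 'h"
    and Q :: "complex ^ 'm \<Rightarrow> 'h"
    and Qstar :: "'h \<Rightarrow> complex ^ 'm"
    and M :: "complex ^ 'm ^ 'm"
  assumes A: "linear_operator D A"
    and linear_Q: "Vector_Spaces.linear scaleC scaleC Q"
    and Qstar: "Qstar = op_adjoint UNIV Q"
    and Qstar_Q [simp]: "Qstar (Q x) = x"
    and Q_in_D: "Q x \<in> D"
    and invariant: "A ` range Q \<subseteq> range Q"
    and M: "M = matrix (\<lambda>x. Qstar (A (Q x)))"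
begin

sublocale Q: Vector_Spaces.linear scaleC scaleC Q
  by (fact linear_Q)

lemma cinner_Qstar: "cinner (Qstar f) x = cinner f (Q x)"
  using cinner_op_adjoint[of UNIV f Q x]
  by (simp add: Qstar adjoint_domain_linear_vec[OF linear_Q])

lemma norm_Q: "norm (Q x) = norm x"
proof -
  have "complex_of_real ((norm (Q x))\<^sup>2) = complex_of_real ((norm x)\<^sup>2)"
    unfolding cinner_self[symmetric] by (simp flip: cinner_Qstar)
  then show ?thesis
    by (simp only: of_real_eq_iff power2_eq_iff_nonneg norm_ge_zero)
qed

text \<open>Cauchy-Schwarz for \<open>f\<close> and \<open>Q (Qstar f)\<close>, with one factor
  \<open>norm (Qstar f)\<close> cancelled because \<open>Q\<close> is isometric.\<close>

lemma norm_Qstar_le: "norm (Qstar f) \<le> norm f"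
proof -
  have "complex_of_real ((norm (Qstar f))\<^sup>2) = cinner f (Q (Qstar f))"
    by (simp only: cinner_self flip: cinner_Qstar)
  then have "norm (Qstar f) * norm (Qstar f) = cmod (cinner f (Q (Qstar f)))"
    by (metis norm_of_real abs_power2 power2_eq_square)
  also have "\<dots> \<le> norm f * norm (Qstar f)"
    using norm_cinner_le[of f "Q (Qstar f)"] by (simp only: norm_Q)
  finally have "norm (Qstar f) * norm (Qstar f) \<le> norm f * norm (Qstar f)" .
  then show ?thesis
    by (metis mult_right_le_imp_le norm_ge_zero order_le_less)
qed

lemma Qstar_add: "Qstar (f + g) = Qstar f + Qstar g"
  by (rule cinner_eqI) (simp add: cinner_Qstar cinner_add_left)

lemma Qstar_scaleC: "Qstar (c *\<^sub>C f) = c *\<^sub>C Qstar f"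
  by (rule cinner_eqI) (simp add: cinner_Qstar cinner_scaleC_left)

lemma bounded_linear_Q: "bounded_linear Q"
  by (rule bounded_linear_intro[where K = 1]) (simp_all add: Q.add Q.scale scaleR_scaleC norm_Q)

lemma bounded_linear_Qstar: "bounded_linear Qstar"
  by (rule bounded_linear_intro[where K = 1])
    (simp_all add: Qstar_add Qstar_scaleC scaleR_scaleC norm_Qstar_le)

lemma Q_eq_0_iff [simp]: "Q x = 0 \<longleftrightarrow> x = 0"
  using norm_Q[of x] by (metis norm_eq_zero)

lemma Q_Qstar: "f \<in> range Q \<Longrightarrow> Q (Qstar f) = f"
  by auto

section \<open>The matrix \<open>M\<close> and its resolvent\<close>

lemma M_mult: "M *v x = Qstar (A (Q x))"
proof -
  \<comment> \<open>\<open>matrix\<close> reproduces a map by multiplication once that map is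
    linear; here this rests on linearity of \<open>A\<close> on \<open>D\<close>, which contains
    \<open>range Q\<close>.\<close>
  have "Vector_Spaces.linear (*s) (*s) (\<lambda>x. Qstar (A (Q x)))"
    using A Q_in_D
    by unfold_locales (simp_all add: Q.add Q.scale Qstar_add Qstar_scaleC linear_operator_def
        flip: scaleC_vec_eq)
  then show ?thesis
    by (simp add: M matrix_works)
qed

text \<open>The intertwining relation behind all later transfers: by invariance
  \<open>A (Q x)\<close> lies in \<open>range Q\<close>, where \<open>Q\<close> undoes
  \<open>Qstar\<close>.\<close>

lemma Q_M: "Q (M *v x) = A (Q x)"
  using invariant by (auto simp: M_mult intro!: Q_Qstar)

lemma linear_operator_M: "linear_operator UNIV ((*v) M)"
  by (simp add: linear_operator_def scaleC_vec_eq matrix_vector_right_distrib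
      vector_scalar_commute complex_vector.subspace_UNIV)

lemma bounded_linear_M: "bounded_linear ((*v) M)"
  using linear_operator_M
  by (auto simp: linear_operator_def scaleR_scaleC intro!: linearI linear_bounded)

text \<open>One of the conditions under which \<open>condition_number\<close> has its intended
  value.\<close>

lemma closed_operator_M: "closed_operator UNIV ((*v) M)"
proof -
  have "(\<lambda>x. (x, M *v x)) ` UNIV = {p. snd p = M *v fst p}"
    by force
  moreover have "closed {p. snd p = M *v fst p}"
    by (intro closed_Collect_eq continuous_intros
        bounded_linear.continuous_on[OF bounded_linear_M])
  ultimately show ?thesis
    by (simp add: closed_operator_def linear_operator_M)
qed

text \<open>The resolvent of \<open>A\<close>, compressed by \<open>Q\<close> and
  \<open>Qstar\<close>, is a left inverse of \<open>z - M\<close>; finite dimension makes it a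
  two-sided one.\<close>

lemma
  assumes z: "z \<in> resolvent_set D A"
  shows resolvent_set_M: "z \<in> resolvent_set UNIV ((*v) M)"
    and Q_resolvent_M: "Q (resolvent UNIV ((*v) M) z x) = resolvent D A z (Q x)"
proof -
  let ?T = "\<lambda>x. z *\<^sub>C x - M *v x"
  have Q_T: "Q (?T x) = z *\<^sub>C Q x - A (Q x)" for x
    by (simp add: Q.diff Q.scale Q_M)
  have left: "Qstar (resolvent D A z (Q (?T x))) = x" for x
    by (simp add: Q_T resolvent_left_inverse[OF z Q_in_D])
  have inj: "inj ?T"
    by (rule inj_on_inverseI) (rule left)
  have "linear ?T"
    by (intro bounded_linear.linear bounded_linear_sub bounded_linear_M
        bounded_bilinear.bounded_linear_right[OF bounded_bilinear_scaleC])
  then have bij: "bij ?T"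
    using inj by (simp add: bij_def linear_injective_imp_surjective)
  have res: "resolvent UNIV ((*v) M) z = (\<lambda>x. Qstar (resolvent D A z (Q x)))"
  proof
    fix x
    obtain y where "x = ?T y"
      using surjD[OF bij_is_surj[OF bij]] by blast
    then show "resolvent UNIV ((*v) M) z x = Qstar (resolvent D A z (Q x))"
      unfolding resolvent_def[of UNIV] using left the_inv_into_f_f[OF inj] by simp
  qed
  have "bounded_linear (resolvent UNIV ((*v) M) z)"
    unfolding res
    by (intro bounded_linear_compose[OF bounded_linear_Qstar]
        bounded_linear_compose[OF bounded_linear_resolvent[OF z]] bounded_linear_Q)
  then show zM: "z \<in> resolvent_set UNIV ((*v) M)"
    using bij by (simp add: resolvent_set_def)
  show "Q (resolvent UNIV ((*v) M) z x) = resolvent D A z (Q x)"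
    by (rule resolvent_eqI[OF z Q_in_D, symmetric])
      (simp add: resolvent_right_inverse[OF zM] flip: Q_T)
qed

text \<open>\<open>Q\<close> passes under the integral and intertwines the two resolvents along the
  same circle.\<close>

lemma Q_spectral_projector_M:
  assumes "r > 0" and "sphere lam r \<subseteq> resolvent_set D A"
  shows "Q (spectral_projector UNIV ((*v) M) lam r x) = spectral_projector D A lam r (Q x)"
proof -
  have "Q (vec_contour_integral (circlepath lam r) (\<lambda>z. resolvent UNIV ((*v) M) z x))
      = vec_contour_integral (circlepath lam r) (\<lambda>z. Q (resolvent UNIV ((*v) M) z x))"
    by (intro vec_contour_integral_linear[symmetric] bounded_linear_Q
        integrable_resolvent_circlepath)
      (use assms resolvent_set_M in \<open>auto simp: Q.scale\<close>)
  also have "\<dots> = vec_contour_integral (circlepath lam r) (\<lambda>z. resolvent D A z (Q x))"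
    using assms by (intro vec_contour_integral_cong Q_resolvent_M) auto
  finally show ?thesis
    by (simp add: spectral_projector_def Q.scale)
qed

lemma simple_eigenvalue_M:
  assumes "simple_eigenvalue D A lam" and "u \<noteq> 0" and "M *v u = lam *\<^sub>C u"
  shows "simple_eigenvalue UNIV ((*v) M) lam"
proof -
  obtain r where r: "r > 0" "cball lam r \<inter> spectrum D A = {lam}"
    and dim: "complex_vector.dim (range (spectral_projector D A lam r)) = 1"
    using assms(1) by (auto simp: simple_eigenvalue_def)
  have sph: "sphere lam r \<subseteq> resolvent_set D A"
    using r by (intro sphere_subset_resolvent_set) auto
  have sphM: "sphere lam r \<subseteq> resolvent_set UNIV ((*v) M)"
    using sph resolvent_set_M by blast
  have sub: "spectrum UNIV ((*v) M) \<subseteq> spectrum D A"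
    using resolvent_set_M by (auto simp: spectrum_def)
  \<comment> \<open>Inclusion of the spectra does not put \<open>lam\<close> in the smaller one. The
    eigenvector does: \<open>lam - M\<close> sends both \<open>u\<close> and 0 to 0.\<close>
  have lam: "lam \<in> spectrum UNIV ((*v) M)"
  proof -
    have "lam *\<^sub>C u - M *v u = lam *\<^sub>C 0 - M *v 0"
      by (simp add: assms(3))
    then have "lam \<notin> resolvent_set UNIV ((*v) M)"
      using resolvent_left_inverse[of lam UNIV "(*v) M"] assms(2) by (metis UNIV_I)
    then show ?thesis
      by (simp add: spectrum_def)
  qed
  obtain T where "open T" "T \<inter> spectrum D A = {lam}"
    using assms(1) by (auto simp: simple_eigenvalue_def isolated_in_def)
  then have "open T \<and> T \<inter> spectrum UNIV ((*v) M) = {lam}"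
    using sub lam by fast
  then have iso: "lam isolated_in spectrum UNIV ((*v) M)"
    using lam unfolding isolated_in_def by blast
  have ball: "cball lam r \<inter> spectrum UNIV ((*v) M) = {lam}"
    using sub r(2) lam by fast
  have Qu: "A (Q u) = lam *\<^sub>C Q u"
    using assms(3) by (metis Q_M Q.scale)
  have "\<exists>c. spectral_projector UNIV ((*v) M) lam r x = c *\<^sub>C u" for x
  proof -
    obtain c where "spectral_projector D A lam r (Q x) = c *\<^sub>C Q u"
      using spectral_projector_rank_one[OF A r(1) sph Q_in_D _ Qu dim] assms(2) by auto
    \<comment> \<open>The multiple of \<open>Q u\<close> is pulled back along the injective
      \<open>Q\<close>, with the same scalar \<open>c\<close>.\<close>
    then have "Q (spectral_projector UNIV ((*v) M) lam r x) = Q (c *\<^sub>C u)"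
      by (simp add: Q_spectral_projector_M[OF r(1) sph] Q.scale)
    then show ?thesis
      by (metis Qstar_Q)
  qed
  moreover have "u \<in> range (spectral_projector UNIV ((*v) M) lam r)"
    using spectral_projector_eigenvector[OF linear_operator_M r(1) sphM UNIV_I assms(3)]
    by (metis rangeI)
  ultimately have "complex_vector.dim (range (spectral_projector UNIV ((*v) M) lam r)) = 1"
    by (subst dim_eq_1_iff[OF _ assms(2)]) auto
  then show ?thesis
    unfolding simple_eigenvalue_def using iso ball r(1) by blast
qed

end

section \<open>Eigenvectors and condition number of the compressed matrix\<close>

theorem theorem3p1:
  fixes D :: "'h::chilbert_space set"
    and \<L> :: "'h \<Rightarrow> 'h"
    and Q :: "complex ^ 'm \<Rightarrow> 'h"
    and Qstar :: "'h \<Rightarrow> complex ^ 'm"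
    and L :: "complex ^ 'm ^ 'm"
    and lam :: complex
    and u w :: 'h
  assumes "closed_operator D \<L>" and "densely_defined D"
    and "Vector_Spaces.linear scaleC scaleC Q"
    and Qstar: "Qstar = op_adjoint UNIV Q"
    and "\<And>x. Qstar (Q x) = x"
    and "range Q \<subseteq> D" and "\<L> ` range Q \<subseteq> range Q"
    and L: "L = matrix (\<lambda>x. Qstar (\<L> (Q x)))"
    and "simple_eigenvalue D \<L> lam"
    and "u \<in> range Q" and "u \<noteq> 0" and "\<L> u = lam *\<^sub>C u"
    and "w \<in> adjoint_domain D \<L>" and "w \<noteq> 0" and "op_adjoint D \<L> w = cnj lam *\<^sub>C w"
  shows "(L *v Qstar u = lam *\<^sub>C Qstar u \<and>
           conjugate_transpose L *v Qstar w = cnj lam *\<^sub>C Qstar w) \<and>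
         cinner (Qstar w) (Qstar u) = cinner w u \<and>
         condition_number UNIV (\<lambda>x. L *v x) lam (Qstar u) (Qstar w)
           \<le> condition_number D \<L> lam u w"
proof -
  have A: "linear_operator D \<L>"
    using assms(1) by (simp add: closed_operator_def)
  interpret invariant_subspace D \<L> Q Qstar L
    using A assms by (intro invariant_subspace.intro) auto
  define u' w' where "u' = Qstar u" and "w' = Qstar w"
  have u: "Q u' = u"
    using assms(10) by (simp only: u'_def Q_Qstar)
  have uD: "u \<in> D"
    using Q_in_D u by metis
  have u': "u' \<noteq> 0" "L *v u' = lam *\<^sub>C u'"
    using u assms(11,12) by (auto simp: M_mult Qstar_scaleC u'_def)
  have w: "cinner w (\<L> f) = lam * cinner w f" if "f \<in> D" for f
    using cinner_op_adjoint[OF assms(2) assms(13) that] assms(15) by (simp add: cinner_scaleC_left)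
  \<comment> \<open>The left eigenvector equation passes from \<open>w\<close> to \<open>w'\<close>
    by moving \<open>Qstar\<close> across as \<open>Q\<close> and intertwining \<open>L\<close> with
    \<open>\<L>\<close>.\<close>
  have w': "cinner w' (L *v x) = cinner (cnj lam *\<^sub>C w') x" for x
    by (simp add: w'_def cinner_Qstar Q_M w Q_in_D cinner_scaleC_left)
  have inner: "cinner w' u' = cinner w u"
    by (simp add: w'_def cinner_Qstar u)
  have nz: "cinner w u \<noteq> 0"
    using simple_eigenvalue_cinner_nonzero[OF A assms(9) uD assms(11,12,14) w] .
  have left: "conjugate_transpose L *v w' = cnj lam *\<^sub>C w'"
    by (rule cinner_eqI) (simp add: cinner_conjugate_transpose w')
  have "w' \<noteq> 0"
    using inner nz by auto
  moreover have "w' \<in> adjoint_domain UNIV ((*v) L)"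
    using w' by (auto simp: adjoint_domain_def)
  moreover have "op_adjoint UNIV ((*v) L) w' = cnj lam *\<^sub>C w'"
    by (rule op_adjoint_eqI) (simp_all add: w')
  \<comment> \<open>All conditions in \<open>condition_number\<close> now hold for the matrix, so
    its value is the quotient, with the same denominator as for \<open>\<L>\<close>.\<close>
  ultimately have "condition_number UNIV ((*v) L) lam u' w'
      = norm u' * norm w' / cmod (cinner w u)"
    using u' closed_operator_M simple_eigenvalue_M[OF assms(9) u']
    by (simp add: condition_number_def inner)
  also have "\<dots> \<le> norm u * norm w / cmod (cinner w u)"
    using norm_Q[of u'] norm_Qstar_le[of w]
    by (intro divide_right_mono mult_mono) (simp_all add: u w'_def)
  also have "\<dots> = condition_number D \<L> lam u w"
    using assms uD by (simp add: condition_number_def)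
  finally show ?thesis
    using u'(2) left inner by (simp add: u'_def w'_def)
qed

end
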